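(* Let $s\ge1$ be fixed, let $0\le k_1\le k_2\le\cdots\le k_s$ be integers and $N\ge k_s+1$; set $k_{s+1}:=N$. Then $$\frac{W(N,k_1,\ldots,k_s)}{N!}=\frac1N\sum_{r=1}^{s}B_r,$$ where $$B_r=k_r\sum_{i=k_r}^{k_{r+1}-1}\frac1i+\sum_{j=1}^{r-1}k_{r-j}\sum_{i_1=k_r+1}^{k_{r+1}-1}\frac1{i_1}\sum_{i_2=k_r}^{i_1-1}\frac1{i_2}\sum_{i_3=k_{r-1}}^{i_2-1}\frac1{i_3}\cdots\sum_{i_{j+1}=k_{r-j+1}}^{i_j-1}\frac1{i_{j+1}}.$$ For instance $B_1=k_1\sum_{i=k_1}^{k_2-1}\frac1i$, $B_2=k_2\sum_{i=k_2}^{k_3-1}\frac1i+k_1\sum_{i_1=k_2+1}^{k_3-1}\frac1{i_1}\sum_{i_2=k_2}^{i_1-1}\frac1{i_2}$, and $B_s=k_s\sum_{i=k_s}^{N-1}\frac1i+k_{s-1}\sum_{i_1=k_s+1}^{N-1}\frac1{i_1}\sum_{i_2=k_s}^{i_1-1}\frac1{i_2}+\cdots+k_1\sum_{i_1=k_s+1}^{N-1}\frac1{i_1}\sum_{i_2=k_s}^{i_1-1}\frac1{i_2}\cdots\sum_{i_s=k_2}^{i_{s-1}-1}\frac1{i_s}$. A summation whose upper limit is smaller than its lower limit is empty.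
   Context: For integers $0\le k_1\le\cdots\le k_s$, the $(k_1,\ldots,k_s)$-strategy applied to a permutation $\pi\in S_N$ (entries revealed from the left, only relative order observed) proceeds as follows: for the $i$-th selection ($1\le i\le s$) it waits until the $(i-1)$-th selection has been made (if $i\ge2$), rejects the first $k_i$ positions, and selects the next position that is a left-to-right maximum of $\pi$ (a position whose value exceeds all values to its left); at most $s$ selections are made. $W(N,k_1,\ldots,k_s)$ denotes the number of $\pi\in S_N$ for which the position holding the value $N$ is selected by this strategy; thus $W(N,k_1,\ldots,k_s)/N!$ is the probability that the strategy selects the best applicant when $\pi$ is uniformly random.
   Formalization: When some k_i = 0 the displayed formula contains the undefined product 0·(1/0); the formal statement multiplies the coefficient into the innermost sum and reads k·(1/k) as 1 also for k = 0. For positive k_i the formula is as displayed. *)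

theory Defs
  imports Complex_Main "HOL-Combinatorics.Permutations"
begin

text \<open>A permutation in \<open>S_N\<close> is a function \<open>\<pi>\<close> with \<open>\<pi> permutes {1..N}\<close>; \<open>\<pi> p\<close> is the value at
  position \<open>p\<close>.\<close>

definition lr_max :: "(nat \<Rightarrow> nat) \<Rightarrow> nat \<Rightarrow> bool" where
  "lr_max \<pi> p \<longleftrightarrow> (\<forall>q\<in>{1..<p}. \<pi> q < \<pi> p)"

definition next_lr_max :: "nat \<Rightarrow> (nat \<Rightarrow> nat) \<Rightarrow> nat \<Rightarrow> nat \<Rightarrow> bool" where
  "next_lr_max N \<pi> m p \<longleftrightarrow>
     p \<in> {m<..N} \<and> lr_max \<pi> p \<and> (\<forall>q\<in>{m<..<p}. \<not> lr_max \<pi> q)"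

text \<open>\<open>selection N k \<pi> i p\<close>: the \<open>i\<close>-th selection of the strategy with thresholds
  \<open>k 1, k 2, \<dots>\<close> is made and is position \<open>p\<close>. The rejected ``first \<open>k i\<close> positions''
  are the absolute positions \<open>1, \<dots>, k i\<close>, whether or not the preceding selection
  lies among them.\<close>

inductive selection :: "nat \<Rightarrow> (nat \<Rightarrow> nat) \<Rightarrow> (nat \<Rightarrow> nat) \<Rightarrow> nat \<Rightarrow> nat \<Rightarrow> bool"
  for N :: nat and k :: "nat \<Rightarrow> nat" and \<pi> :: "nat \<Rightarrow> nat" where
  first: "next_lr_max N \<pi> (k 1) p \<Longrightarrow> selection N k \<pi> 1 p"
| later: "selection N k \<pi> i q \<Longrightarrow> next_lr_max N \<pi> (max q (k (Suc i))) p
           \<Longrightarrow> selection N k \<pi> (Suc i) p"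

definition W :: "nat \<Rightarrow> nat \<Rightarrow> (nat \<Rightarrow> nat) \<Rightarrow> nat" where
  "W N s k = card {\<pi>. \<pi> permutes {1..N} \<and>
                     (\<exists>i\<in>{1..s}. \<exists>p. selection N k \<pi> i p \<and> \<pi> p = N)}"

text \<open>\<open>iter_sum [a\<^sub>1, \<dots>, a\<^sub>n] u\<close> is the iterated sum
  \<open>\<Sum>i\<^sub>1=a\<^sub>1..u-1. 1/i\<^sub>1 * (\<Sum>i\<^sub>2=a\<^sub>2..i\<^sub>1-1. 1/i\<^sub>2 * (\<dots> (\<Sum>i\<^sub>n=a\<^sub>n..i\<^sub>n\<^sub>-\<^sub>1-1. 1/i\<^sub>n)))\<close>.\<close>

fun iter_sum :: "nat list \<Rightarrow> nat \<Rightarrow> real" where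
  "iter_sum [] u = 1"
| "iter_sum (a # as) u = (\<Sum>i\<in>{a..<u}. 1 / real i * iter_sum as i)"

text \<open>Products \<open>c * iter_sum as u\<close> occur in the formula also with \<open>c = 0\<close> and a summation
  index of the innermost sum equal to \<open>0\<close>. There the formula is to be read with
  \<open>c * (1/c) = 1\<close> for \<open>c = 0\<close> too (e.g. \<open>W(N,0)/N! = 1/N\<close>, as the \<open>(0)\<close>-strategy
  always selects position \<open>1\<close>), whereas \<open>1 / 0 = 0\<close> in HOL. Hence the coefficient is
  multiplied into the innermost sum. For \<open>c > 0\<close> nothing changes, see
  \<open>coeff_iter_sum_eq\<close>; indices of outer sums that are \<open>0\<close> have an empty inner sum.\<close>

definition coeff_quot :: "nat \<Rightarrow> nat \<Rightarrow> real" where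
  "coeff_quot c i = (if i = c then 1 else real c / real i)"

fun coeff_iter_sum :: "nat \<Rightarrow> nat list \<Rightarrow> nat \<Rightarrow> real" where
  "coeff_iter_sum c [] u = real c"
| "coeff_iter_sum c [a] u = (\<Sum>i\<in>{a..<u}. coeff_quot c i)"
| "coeff_iter_sum c (a # b # as) u =
     (\<Sum>i\<in>{a..<u}. 1 / real i * coeff_iter_sum c (b # as) i)"

lemma coeff_iter_sum_eq:
  assumes "c > 0"
  shows "coeff_iter_sum c as u = real c * iter_sum as u"
  using assms
proof (induction c as u rule: coeff_iter_sum.induct)
  case (2 c a u)
  then show ?case
    by (auto simp: sum_distrib_left coeff_quot_def intro!: sum.cong)
qed (auto simp: sum_distrib_left mult.left_commute)

text \<open>For \<open>1 \<le> j < r\<close>, the lower limits in the \<open>j\<close>-th term are \<open>k r + 1\<close> for \<open>i\<^sub>1\<close> and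
  \<open>k r, k (r-1), \<dots>, k (r-j+1)\<close> for \<open>i\<^sub>2, \<dots>, i\<^sub>j\<^sub>+\<^sub>1\<close>.\<close>

definition B :: "(nat \<Rightarrow> nat) \<Rightarrow> nat \<Rightarrow> real" where
  "B k r = coeff_iter_sum (k r) [k r] (k (r + 1)) +
     (\<Sum>j\<in>{1..<r}. coeff_iter_sum (k (r - j))
                     ((k r + 1) # map (\<lambda>l. k (r - l)) [0..<j]) (k (r + 1)))"

lemma B_pos:
  assumes "\<And>i. i \<in> {1..r} \<Longrightarrow> k i > 0" and "r \<ge> 1"
  shows "B k r = real (k r) * (\<Sum>i\<in>{k r..<k (r + 1)}. 1 / real i) +
     (\<Sum>j\<in>{1..<r}. real (k (r - j)) *
        (\<Sum>i\<^sub>1\<in>{k r + 1..<k (r + 1)}. 1 / real i\<^sub>1 * iter_sum (map (\<lambda>l. k (r - l)) [0..<j]) i\<^sub>1))"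
proof -
  have "coeff_iter_sum (k r) [k r] (k (r + 1)) =
        real (k r) * (\<Sum>i\<in>{k r..<k (r + 1)}. 1 / real i)"
    using assms by (subst coeff_iter_sum_eq) auto
  moreover have "coeff_iter_sum (k (r - j))
      ((k r + 1) # map (\<lambda>l. k (r - l)) [0..<j]) (k (r + 1)) =
      real (k (r - j)) *
      (\<Sum>i\<^sub>1\<in>{k r + 1..<k (r + 1)}. 1 / real i\<^sub>1 * iter_sum (map (\<lambda>l. k (r - l)) [0..<j]) i\<^sub>1)"
    if "j \<in> {1..<r}" for j
    using assms that by (subst coeff_iter_sum_eq) auto
  ultimately show ?thesis
    unfolding B_def by simp
qed

lemma B_1: "k 1 > 0 \<Longrightarrow> B k 1 = real (k 1) * (\<Sum>i\<in>{k 1..<k 2}. 1 / real i)"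
  using B_pos[of 1 k] by (simp add: numeral_2_eq_2)

lemma B_2:
  assumes "k 1 > 0" "k 2 > 0"
  shows "B k 2 = real (k 2) * (\<Sum>i\<in>{k 2..<k 3}. 1 / real i) +
    real (k 1) * (\<Sum>i\<^sub>1\<in>{k 2 + 1..<k 3}. 1 / real i\<^sub>1 * (\<Sum>i\<^sub>2\<in>{k 2..<i\<^sub>1}. 1 / real i\<^sub>2))"
proof -
  have "k i > 0" if "i \<in> {1..2}" for i
    using assms that by (cases "i = 1") (auto simp: le_Suc_eq numeral_2_eq_2)
  moreover have "{1..<2::nat} = {1}" by auto
  ultimately show ?thesis
    using B_pos[of 2 k] by simp
qed

end

theory Submission
  imports Defs
begin

text \<open>Let \<open>c m\<close> be the number of selections made among the first \<open>m\<close> positions. The value \<open>N\<close>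
  at position \<open>m + 1\<close> is selected iff \<open>c m < s\<close> and \<open>k (c m + 1) \<le> m\<close>; for
  \<open>k r \<le> m < k (r + 1)\<close> this says \<open>c m < r\<close>. Building a permutation by appending a last value of
  arbitrary relative rank shows that position \<open>m + 1\<close> is a left-to-right maximum with
  probability \<open>1 / (m + 1)\<close>, independently of what precedes it. So
  \<open>N * W / N! = (\<Sum>m<N. P (c m < r m))\<close> where \<open>r m\<close> is the number of thresholds \<open>\<le> m\<close>, and
  \<open>(m + 1) P (c (m + 1) < r) = m P (c m < r) + P (c m < r - 1)\<close> for \<open>m \<ge> k r\<close>, with
  \<open>P (c m < r) = 1\<close> for \<open>m \<le> k r\<close>. Unrolling this recursion gives the iterated sums.\<close>

section \<open>Appending a last value\<close>

text \<open>\<open>ins_value N v \<circ> \<sigma>\<close> is the permutation with last value \<open>v\<close> whose other values are ordered as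
  those of \<open>\<sigma>\<close>.\<close>

definition ins_value :: "nat \<Rightarrow> nat \<Rightarrow> nat \<Rightarrow> nat" where
  "ins_value N v x = (if x = Suc N then v else if v \<le> x \<and> x \<le> N then Suc x else x)"

lemma ins_value_permutes:
  assumes "v \<in> {1..Suc N}"
  shows "ins_value N v permutes {1..Suc N}"
proof (rule bij_imp_permutes)
  have "ins_value N v ` {1..Suc N} = {1..Suc N}"
    by (rule endo_inj_surj) (use assms in \<open>auto simp: ins_value_def inj_on_def split: if_splits\<close>)
  moreover have "inj_on (ins_value N v) {1..Suc N}"
    by (auto simp: ins_value_def inj_on_def split: if_splits)
  ultimately show "bij_betw (ins_value N v) {1..Suc N} {1..Suc N}"
    by (simp add: bij_betw_def)
qed (use assms in \<open>auto simp: ins_value_def\<close>)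

lemma permutes_fixes_Suc: "\<sigma> permutes {1..N} \<Longrightarrow> \<sigma> (Suc N) = Suc N"
  by (simp add: permutes_def)

lemma permutes_in_range: "\<sigma> permutes {1..N} \<Longrightarrow> p \<in> {1..N} \<Longrightarrow> \<sigma> p \<in> {1..N::nat}"
  by (simp only: permutes_in_image)

text \<open>Evaluation at \<open>Suc N\<close>, which \<open>\<sigma>\<close> fixes, recovers
  \<open>v\<close>; then the injective map \<open>ins_value N v\<close> cancels on the left.\<close>

lemma inj_on_append_value:
  "inj_on (\<lambda>(v, \<sigma>). ins_value N v \<circ> \<sigma>) ({1..Suc N} \<times> {\<sigma>. \<sigma> permutes {1..N}})"
proof (rule inj_onI, clarify)
  fix v w \<sigma> \<tau>
  assume vw: "v \<in> {1..Suc N}" "w \<in> {1..Suc N}" and perm: "\<sigma> permutes {1..N}" "\<tau> permutes {1..N}"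
    and eq: "ins_value N v \<circ> \<sigma> = ins_value N w \<circ> \<tau>"
  from fun_cong[OF eq, of "Suc N"] have "v = w"
    by (simp add: permutes_fixes_Suc[OF perm(1)] permutes_fixes_Suc[OF perm(2)] ins_value_def)
  moreover have "inj (ins_value N v)"
    using ins_value_permutes[OF vw(1)] by (rule permutes_inj)
  ultimately show "v = w \<and> \<sigma> = \<tau>"
    using eq by (auto simp: fun_eq_iff dest: injD)
qed

text \<open>Surjectivity comes from counting: the map is injective, and its domain and target both
  have \<open>Suc N * fact N\<close> elements.\<close>

lemma image_append_value:
  "(\<lambda>(v, \<sigma>). ins_value N v \<circ> \<sigma>) ` ({1..Suc N} \<times> {\<sigma>. \<sigma> permutes {1..N}}) =
    {\<pi>. \<pi> permutes {1..Suc N}}"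
proof (rule card_subset_eq)
  show "finite {\<pi>. \<pi> permutes {1..Suc N}}"
    by (simp add: finite_permutations)
  show "(\<lambda>(v, \<sigma>). ins_value N v \<circ> \<sigma>) ` ({1..Suc N} \<times> {\<sigma>. \<sigma> permutes {1..N}})
      \<subseteq> {\<pi>. \<pi> permutes {1..Suc N}}"
  proof clarify
    fix v \<sigma> assume v: "v \<in> {1..Suc N}" and "\<sigma> permutes {1..N}"
    then have "\<sigma> permutes {1..Suc N}"
      using permutes_subset[of \<sigma> "{1..N}" "{1..Suc N}"] by simp
    then show "ins_value N v \<circ> \<sigma> permutes {1..Suc N}"
      using ins_value_permutes[OF v] by (rule permutes_compose)
  qed
  show "card ((\<lambda>(v, \<sigma>). ins_value N v \<circ> \<sigma>) ` ({1..Suc N} \<times> {\<sigma>. \<sigma> permutes {1..N}})) =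
      card {\<pi>. \<pi> permutes {1..Suc N}}"
    by (simp only: card_image[OF inj_on_append_value] card_cartesian_product
        card_permutations[OF refl finite_atLeastAtMost] card_atLeastAtMost) simp
qed

text \<open>Source of the recursions below: if, for given \<open>\<sigma>\<close>, \<open>Q\<close>
  depends only on whether the appended value is the largest, then the \<open>N\<close> smaller
  values share one condition and the value \<open>Suc N\<close> has its own.\<close>

lemma card_permutes_Suc:
  assumes last: "\<And>\<sigma>. \<sigma> permutes {1..N} \<Longrightarrow> Q (ins_value N (Suc N) \<circ> \<sigma>) \<longleftrightarrow> Q1 \<sigma>"
    and less: "\<And>\<sigma> v. \<sigma> permutes {1..N} \<Longrightarrow> v \<in> {1..N} \<Longrightarrow> Q (ins_value N v \<circ> \<sigma>) \<longleftrightarrow> Q0 \<sigma>"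
  shows "card {\<pi>. \<pi> permutes {1..Suc N} \<and> Q \<pi>} =
    N * card {\<sigma>. \<sigma> permutes {1..N} \<and> Q0 \<sigma>} + card {\<sigma>. \<sigma> permutes {1..N} \<and> Q1 \<sigma>}"
proof -
  let ?F = "\<lambda>(v, \<sigma>). ins_value N v \<circ> \<sigma>"
  let ?A = "{1..N} \<times> {\<sigma>. \<sigma> permutes {1..N} \<and> Q0 \<sigma>}"
  let ?B = "{Suc N} \<times> {\<sigma>. \<sigma> permutes {1..N} \<and> Q1 \<sigma>}"
  let ?D = "{1..Suc N} \<times> {\<sigma>. \<sigma> permutes {1..N}}"
  have split: "{x \<in> ?D. Q (?F x)} = ?A \<union> ?B"
    using last less by (auto simp: le_Suc_eq)
  have fin: "finite {\<sigma>. \<sigma> permutes {1..N} \<and> R \<sigma>}" for R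
    by (rule finite_subset[OF _ finite_permutations[of "{1..N}"]]) auto
  have "{\<pi>. \<pi> permutes {1..Suc N} \<and> Q \<pi>} = {\<pi> \<in> ?F ` ?D. Q \<pi>}"
    by (simp only: image_append_value) simp
  also have "\<dots> = ?F ` {x \<in> ?D. Q (?F x)}" by blast
  finally have "card {\<pi>. \<pi> permutes {1..Suc N} \<and> Q \<pi>} = card (?F ` {x \<in> ?D. Q (?F x)})"
    by (rule arg_cong)
  also have "\<dots> = card (?A \<union> ?B)"
    unfolding split[symmetric] by (rule card_image, rule inj_on_subset[OF inj_on_append_value]) blast
  also have "\<dots> = card ?A + card ?B"
  proof (rule card_Un_disjoint)
    show "finite ?A" by (rule finite_cartesian_product[OF finite_atLeastAtMost fin])
    show "finite ?B" by (rule finite_cartesian_product[OF _ fin]) simp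
    show "?A \<inter> ?B = {}" by auto
  qed
  finally show ?thesis by (simp add: card_cartesian_product)
qed

text \<open>\<open>ins_value N v\<close> is strictly increasing on \<open>{1..N}\<close>, so the
  relative order of the first \<open>N\<close> entries survives.\<close>

lemma lr_max_append_value:
  assumes "\<sigma> permutes {1..N}" "p \<in> {1..N}"
  shows "lr_max (ins_value N v \<circ> \<sigma>) p \<longleftrightarrow> lr_max \<sigma> p"
proof -
  have "ins_value N v (\<sigma> q) < ins_value N v (\<sigma> p) \<longleftrightarrow> \<sigma> q < \<sigma> p" if "q \<in> {1..<p}" for q
    using that assms permutes_in_range[of \<sigma> N p] permutes_in_range[of \<sigma> N q]
    by (auto simp: ins_value_def)
  then show ?thesis by (simp add: lr_max_def)
qed

lemma permutes_attains_max:
  assumes "\<sigma> permutes {1..N}" "N > (0::nat)"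
  obtains p where "p \<in> {1..N}" "\<sigma> p = N"
proof -
  have "N \<in> \<sigma> ` {1..N}"
    using assms(2) by (simp only: permutes_image[OF assms(1)]) simp
  then show thesis using that by blast
qed

lemma lr_max_append_value_last:
  assumes "\<sigma> permutes {1..N}" "v \<in> {1..Suc N}"
  shows "lr_max (ins_value N v \<circ> \<sigma>) (Suc N) \<longleftrightarrow> v = Suc N"
proof
  assume *: "lr_max (ins_value N v \<circ> \<sigma>) (Suc N)"
  show "v = Suc N"
  proof (rule ccontr)
    assume "v \<noteq> Suc N"
    with assms have v: "v \<in> {1..N}" by auto
    \<comment> \<open>Since \<open>v <= N\<close>, the value \<open>N\<close> of
      \<open>\<sigma>\<close> is raised to \<open>Suc N\<close>, so position \<open>p\<close>
      exceeds the last one.\<close>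
    then obtain p where "p \<in> {1..N}" "\<sigma> p = N"
      using permutes_attains_max[OF assms(1)] by auto
    with * v show False
      using permutes_fixes_Suc[OF assms(1)]
      by (auto simp: lr_max_def ins_value_def dest!: bspec[of _ _ p])
  qed
next
  assume "v = Suc N"
  then show "lr_max (ins_value N v \<circ> \<sigma>) (Suc N)"
    using permutes_fixes_Suc[OF assms(1)] permutes_in_range[OF assms(1)]
    by (fastforce simp: lr_max_def ins_value_def)
qed

section \<open>Counting selections\<close>

text \<open>The strategy read position by position, without the cap of \<open>s\<close> selections,
  which enters in \<open>sel_best\<close>. The test against \<open>m\<close> says that position
  \<open>m + 1\<close> lies beyond the rejected ones.\<close>

fun num_sel :: "(nat \<Rightarrow> nat) \<Rightarrow> (nat \<Rightarrow> nat) \<Rightarrow> nat \<Rightarrow> nat" where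
  "num_sel k \<pi> 0 = 0"
| "num_sel k \<pi> (Suc m) =
    num_sel k \<pi> m + of_bool (k (Suc (num_sel k \<pi> m)) \<le> m \<and> lr_max \<pi> (Suc m))"

lemma num_sel_mono: "m \<le> n \<Longrightarrow> num_sel k \<pi> m \<le> num_sel k \<pi> n"
  by (induction n rule: dec_induct) auto

lemma num_sel_cong:
  "(\<And>p. p \<in> {1..m} \<Longrightarrow> lr_max \<pi> p \<longleftrightarrow> lr_max \<sigma> p) \<Longrightarrow> num_sel k \<pi> m = num_sel k \<sigma> m"
  by (induction m) auto

text \<open>The count rises by at most one per position, and it can reach \<open>r\<close> only at a
  position beyond \<open>k r\<close>.\<close>

lemma threshold_less_if_num_sel: "r \<ge> 1 \<Longrightarrow> num_sel k \<pi> m \<ge> r \<Longrightarrow> k r < m"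
proof (induction m)
  case (Suc m)
  show ?case
  proof (cases "num_sel k \<pi> m \<ge> r")
    case False
    with Suc.prems have "Suc (num_sel k \<pi> m) = r" "k (Suc (num_sel k \<pi> m)) \<le> m"
      by (auto simp: of_bool_def split: if_splits)
    then show ?thesis by auto
  qed (use Suc in auto)
qed simp

lemma exists_selection_step:
  "num_sel k \<pi> m = Suc i \<Longrightarrow> \<exists>q<m. num_sel k \<pi> q = i \<and> k (Suc i) \<le> q \<and> lr_max \<pi> (Suc q)"
proof (induction m)
  case (Suc m)
  then show ?case
  proof (cases "num_sel k \<pi> m = Suc i")
    case False
    with Suc.prems show ?thesis
      by (intro exI[of _ m]) (auto simp: of_bool_def split: if_splits)
  qed (use less_SucI in blast)
qed simp

lemma num_sel_const:
  assumes "q \<le> m" "\<And>p. p \<in> {max q (k (Suc (num_sel k \<pi> q)))<..m} \<Longrightarrow> \<not> lr_max \<pi> p"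
  shows "num_sel k \<pi> m = num_sel k \<pi> q"
  using assms
proof (induction m rule: dec_induct)
  case (step m)
  then have "num_sel k \<pi> m = num_sel k \<pi> q" by simp
  \<comment> \<open>Position \<open>Suc m\<close> either is no left-to-right maximum or still lies
    within the rejected positions.\<close>
  with step show ?case by (auto simp: of_bool_def)
qed simp

lemma num_sel_next_lr_max:
  assumes "num_sel k \<pi> q = i" "next_lr_max N \<pi> (max q (k (Suc i))) p"
  shows "num_sel k \<pi> (p - 1) = i"
proof -
  have "num_sel k \<pi> (p - 1) = num_sel k \<pi> q"
    using assms by (intro num_sel_const) (auto simp: next_lr_max_def)
  with assms(1) show ?thesis by simp
qed

text \<open>Any left-to-right maximum strictly between would have been selected, raising the count
  above \<open>i\<close> before \<open>p\<close>.\<close>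

lemma next_lr_max_num_sel:
  assumes "num_sel k \<pi> q = i" "num_sel k \<pi> (p - 1) = i" "p \<in> {1..N}" "lr_max \<pi> p"
    "q < p" "k (Suc i) < p"
  shows "next_lr_max N \<pi> (max q (k (Suc i))) p"
  unfolding next_lr_max_def
proof (intro conjI ballI notI)
  fix q' assume q': "q' \<in> {max q (k (Suc i))<..<p}" "lr_max \<pi> q'"
  then obtain m where m: "q' = Suc m" by (cases q') auto
  have "num_sel k \<pi> m = i"
    using num_sel_mono[of q m k \<pi>] num_sel_mono[of m "p - 1" k \<pi>] assms q' m by auto
  with q' m have "num_sel k \<pi> (Suc m) = Suc i" by auto
  moreover have "Suc m \<le> p - 1" using q' m by auto
  ultimately show False
    using num_sel_mono[of "Suc m" "p - 1" k \<pi>] assms(2) by simp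
qed (use assms in auto)

lemma selection_imp_num_sel:
  "selection N k \<pi> i p \<Longrightarrow>
    p \<in> {1..N} \<and> lr_max \<pi> p \<and> i = Suc (num_sel k \<pi> (p - 1)) \<and> k i < p"
proof (induction rule: selection.induct)
  case (first p)
  then show ?case
    using num_sel_next_lr_max[of k \<pi> 0 0 N p] by (auto simp: next_lr_max_def)
next
  case (later i q p)
  \<comment> \<open>By the induction hypothesis the count is \<open>i - 1\<close> just before
    \<open>q\<close>, and \<open>q\<close> itself is counted.\<close>
  then have "num_sel k \<pi> q = i" by (cases q) auto
  with later show ?case
    using num_sel_next_lr_max[of k \<pi> q i N p] by (auto simp: next_lr_max_def)
qed

lemma num_sel_imp_selection:
  assumes "p \<in> {1..N}" "lr_max \<pi> p" "num_sel k \<pi> (p - 1) = i" "k (Suc i) < p"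
  shows "selection N k \<pi> (Suc i) p"
  using assms
proof (induction i arbitrary: p)
  case 0
  then show ?case
    using next_lr_max_num_sel[of k \<pi> 0 0 p N] selection.first[of N \<pi> k p] by auto
next
  case (Suc i)
  \<comment> \<open>\<open>Suc q\<close> is the position of the preceding selection, where the count
    passes from \<open>i\<close> to \<open>Suc i\<close>.\<close>
  obtain q where q: "q < p - 1" "num_sel k \<pi> q = i" "k (Suc i) \<le> q" "lr_max \<pi> (Suc q)"
    using exists_selection_step[OF Suc.prems(3)] by auto
  have "selection N k \<pi> (Suc i) (Suc q)"
    using q Suc.prems by (intro Suc.IH) auto
  moreover have "next_lr_max N \<pi> (max (Suc q) (k (Suc (Suc i)))) p"
    using q Suc.prems by (intro next_lr_max_num_sel) auto
  ultimately show ?case by (rule selection.later)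
qed

text \<open>Trades the inductive process for a count over a prefix, which can be followed when a
  value is appended.\<close>

lemma selection_iff:
  "selection N k \<pi> i p \<longleftrightarrow>
    p \<in> {1..N} \<and> lr_max \<pi> p \<and> i = Suc (num_sel k \<pi> (p - 1)) \<and> k i < p"
  using selection_imp_num_sel num_sel_imp_selection by metis

lemma num_sel_append_value:
  assumes "\<sigma> permutes {1..N}" "m \<le> N"
  shows "num_sel k (ins_value N v \<circ> \<sigma>) m = num_sel k \<sigma> m"
  using assms by (intro num_sel_cong lr_max_append_value) auto

lemma num_sel_append_value_last:
  assumes "\<sigma> permutes {1..N}" "v \<in> {1..Suc N}"
  shows "num_sel k (ins_value N v \<circ> \<sigma>) (Suc N) =
    num_sel k \<sigma> N + of_bool (k (Suc (num_sel k \<sigma> N)) \<le> N \<and> v = Suc N)"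
  using assms by (simp add: num_sel_append_value lr_max_append_value_last del: o_apply)

section \<open>Recursions for the counts\<close>

definition sel_best :: "nat \<Rightarrow> nat \<Rightarrow> (nat \<Rightarrow> nat) \<Rightarrow> (nat \<Rightarrow> nat) \<Rightarrow> bool" where
  "sel_best N s k \<pi> \<longleftrightarrow> (\<exists>p\<in>{1..N}. \<pi> p = N \<and> num_sel k \<pi> (p - 1) < s \<and>
     k (Suc (num_sel k \<pi> (p - 1))) < p)"

lemma lr_max_if_max:
  assumes "\<pi> permutes {1..N}" "p \<in> {1..N}" "\<pi> p = N"
  shows "lr_max \<pi> p"
  unfolding lr_max_def
proof
  fix q assume q: "q \<in> {1..<p}"
  then have "\<pi> q \<noteq> \<pi> p"
    using permutes_inj[OF assms(1)] by (auto dest: injD)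
  moreover have "\<pi> q \<le> N"
    using permutes_in_range[OF assms(1), of q] q assms(2) by auto
  ultimately show "\<pi> q < \<pi> p" using assms(3) by simp
qed

lemma W_eq_card_sel_best: "W N s k = card {\<pi>. \<pi> permutes {1..N} \<and> sel_best N s k \<pi>}"
  unfolding W_def
proof (intro arg_cong[where f = card] Collect_cong conj_cong refl)
  fix \<pi> assume \<pi>: "\<pi> permutes {1..N}"
  show "(\<exists>i\<in>{1..s}. \<exists>p. selection N k \<pi> i p \<and> \<pi> p = N) \<longleftrightarrow> sel_best N s k \<pi>"
  proof
    assume "sel_best N s k \<pi>"
    then obtain p where p: "p \<in> {1..N}" "\<pi> p = N" "num_sel k \<pi> (p - 1) < s"
        "k (Suc (num_sel k \<pi> (p - 1))) < p"
      unfolding sel_best_def by blast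
    then have "selection N k \<pi> (Suc (num_sel k \<pi> (p - 1))) p"
      using lr_max_if_max[OF \<pi>] by (simp add: selection_iff)
    moreover have "Suc (num_sel k \<pi> (p - 1)) \<in> {1..s}" using p(3) by simp
    ultimately show "\<exists>i\<in>{1..s}. \<exists>p. selection N k \<pi> i p \<and> \<pi> p = N"
      using p(2) by blast
  qed (auto simp: selection_iff sel_best_def Suc_le_eq)
qed

lemma sel_best_append_max:
  assumes "\<sigma> permutes {1..N}"
  shows "sel_best (Suc N) s k (ins_value N (Suc N) \<circ> \<sigma>) \<longleftrightarrow>
    num_sel k \<sigma> N < s \<and> k (Suc (num_sel k \<sigma> N)) \<le> N"
proof -
  have "(ins_value N (Suc N) \<circ> \<sigma>) p = Suc N \<longleftrightarrow> p = Suc N" if "p \<in> {1..Suc N}" for p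
    using that permutes_fixes_Suc[OF assms] permutes_in_range[OF assms, of p]
    by (cases "p = Suc N") (auto simp: ins_value_def)
  then show ?thesis
    unfolding sel_best_def using assms
    by (auto simp: num_sel_append_value less_Suc_eq_le simp del: o_apply)
qed

text \<open>The maximum stays at its old position, and the count before that position is
  unchanged.\<close>

lemma sel_best_append_less:
  assumes "\<sigma> permutes {1..N}" "v \<in> {1..N}"
  shows "sel_best (Suc N) s k (ins_value N v \<circ> \<sigma>) \<longleftrightarrow> sel_best N s k \<sigma>"
proof -
  have *: "(ins_value N v \<circ> \<sigma>) p = Suc N \<longleftrightarrow> \<sigma> p = N" if "p \<in> {1..N}" for p
    using that assms permutes_in_range[OF assms(1), of p] by (auto simp: ins_value_def)
  have "(ins_value N v \<circ> \<sigma>) (Suc N) \<noteq> Suc N"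
    using assms permutes_fixes_Suc[OF assms(1)] by (auto simp: ins_value_def)
  then have "sel_best (Suc N) s k (ins_value N v \<circ> \<sigma>) \<longleftrightarrow>
      (\<exists>p\<in>{1..N}. (ins_value N v \<circ> \<sigma>) p = Suc N \<and> num_sel k (ins_value N v \<circ> \<sigma>) (p - 1) < s \<and>
        k (Suc (num_sel k (ins_value N v \<circ> \<sigma>) (p - 1))) < p)"
    unfolding sel_best_def by (auto simp: le_Suc_eq simp del: o_apply)
  also have "\<dots> \<longleftrightarrow> sel_best N s k \<sigma>"
    unfolding sel_best_def
    by (intro bex_cong refl) (use * assms in \<open>auto simp: num_sel_append_value simp del: o_apply\<close>)
  finally show ?thesis .
qed

section \<open>Distribution of the number of selections\<close>

lemma mult_divide_fact_Suc: "real (Suc m) * (x / fact (Suc m)) = x / fact m"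
  by (simp only: fact_Suc) (simp del: of_nat_Suc)

text \<open>The count depends only on the relative order of the first \<open>m\<close> entries, so
  the probability is taken over permutations of length \<open>m\<close>.\<close>

definition prob_num_sel_less :: "(nat \<Rightarrow> nat) \<Rightarrow> nat \<Rightarrow> nat \<Rightarrow> real" where
  "prob_num_sel_less k m r = card {\<sigma>. \<sigma> permutes {1..m} \<and> num_sel k \<sigma> m < r} / fact m"

lemma card_permutes_atLeastAtMost: "card {\<sigma>. \<sigma> permutes {1..m}} = fact m"
  by (simp add: card_permutations)

lemma prob_num_sel_less_0: "prob_num_sel_less k m 0 = 0"
  by (simp add: prob_num_sel_less_def)

lemma prob_num_sel_less_eq_1:
  assumes "m \<le> k r" "r \<ge> 1"
  shows "prob_num_sel_less k m r = 1"
proof -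
  have "num_sel k \<sigma> m < r" for \<sigma>
    using threshold_less_if_num_sel[of r k \<sigma> m] assms by fastforce
  then show ?thesis
    using card_permutes_atLeastAtMost[of m] by (simp add: prob_num_sel_less_def)
qed

lemma prob_num_sel_less_Suc:
  assumes "k (Suc r) \<le> m"
  shows "real (Suc m) * prob_num_sel_less k (Suc m) (Suc r) = real m * prob_num_sel_less k m (Suc r) + prob_num_sel_less k m r"
proof -
  have "card {\<pi>. \<pi> permutes {1..Suc m} \<and> num_sel k \<pi> (Suc m) < Suc r} =
      m * card {\<sigma>. \<sigma> permutes {1..m} \<and> num_sel k \<sigma> m < Suc r} +
      card {\<sigma>. \<sigma> permutes {1..m} \<and> num_sel k \<sigma> m < r}"
  proof (rule card_permutes_Suc)
    fix \<sigma> assume \<sigma>: "\<sigma> permutes {1..m}"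
    show "num_sel k (ins_value m (Suc m) \<circ> \<sigma>) (Suc m) < Suc r \<longleftrightarrow> num_sel k \<sigma> m < r"
      \<comment> \<open>The threshold hypothesis acts exactly when the count is \<open>r\<close>:
        the new maximum is then selected and the count becomes \<open>Suc r\<close>.\<close>
      using assms by (cases "num_sel k \<sigma> m = r")
        (auto simp: num_sel_append_value_last[OF \<sigma>] of_bool_def simp del: num_sel.simps)
    show "num_sel k (ins_value m v \<circ> \<sigma>) (Suc m) < Suc r \<longleftrightarrow> num_sel k \<sigma> m < Suc r"
      if "v \<in> {1..m}" for v
      using that by (auto simp: num_sel_append_value_last[OF \<sigma>] simp del: num_sel.simps)
  qed
  then show ?thesis
    unfolding prob_num_sel_less_def mult_divide_fact_Suc by (simp add: add_divide_distrib)
qed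

text \<open>The recursion telescopes from \<open>m = k (Suc r)\<close>, where the probability is
  1.\<close>

lemma prob_num_sel_less_sum:
  assumes "k (Suc r) \<le> m"
  shows "real m * prob_num_sel_less k m (Suc r) = real (k (Suc r)) + (\<Sum>i\<in>{k (Suc r)..<m}. prob_num_sel_less k i r)"
  using assms
proof (induction m rule: dec_induct)
  case base
  then show ?case by (simp add: prob_num_sel_less_eq_1)
next
  case (step m)
  then show ?case using prob_num_sel_less_Suc[of k r m] by simp
qed

text \<open>Induction on \<open>r\<close>: inserting the formula for \<open>r\<close> into
  \<open>prob_num_sel_less_sum\<close> puts one more summation around each term and so turns index
  \<open>j\<close> into \<open>j + 1\<close>.\<close>

lemma prob_num_sel_less_eq_iter_sum:
  assumes "mono_on {1..r} k" "r \<ge> 1" "k r \<le> m"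
  shows "prob_num_sel_less k m r = coeff_quot (k r) m +
    (\<Sum>j\<in>{1..<r}. 1 / real m * coeff_iter_sum (k (r - j)) (map (\<lambda>l. k (r - l)) [0..<j]) m)"
  using assms
proof (induction r arbitrary: m)
  case (Suc r)
  show ?case
  proof (cases "m = 0")
    case True
    \<comment> \<open>Here \<open>k (Suc r) = 0\<close>: \<open>coeff_quot\<close> gives 1 by its
      convention, and \<open>1 / 0 = 0\<close> removes the other terms.\<close>
    with Suc.prems show ?thesis by (simp add: prob_num_sel_less_eq_1 coeff_quot_def)
  next
    case False
    let ?c = "\<lambda>j. coeff_iter_sum (k (Suc r - j)) (map (\<lambda>l. k (Suc r - l)) [0..<j]) m"
    have "(\<Sum>i\<in>{k (Suc r)..<m}. prob_num_sel_less k i r) = (\<Sum>j\<in>{1..<Suc r}. ?c j)"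
    proof (cases "r = 0")
      case False
      have mono: "mono_on {1..r} k"
        using Suc.prems(1) by (rule mono_on_subset) auto
      have le: "k r \<le> k (Suc r)"
        using mono_onD[OF Suc.prems(1), of r "Suc r"] False by auto
      have unfold: "map (\<lambda>l. k (Suc r - l)) [0..<Suc j] = k (Suc r) # map (\<lambda>l. k (r - l)) [0..<j]" for j
        by (simp add: upt_rec[of 0] map_Suc_upt[symmetric] del: upt_Suc)
      \<comment> \<open>The term \<open>j = 1\<close> comes from the leading quotient for
        \<open>r\<close>; the term \<open>Suc j\<close> comes from the \<open>j\<close>-th term for
        \<open>r\<close>.\<close>
      have c1: "?c 1 = (\<Sum>i\<in>{k (Suc r)..<m}. coeff_quot (k r) i)" by simp
      have cSuc: "?c (Suc j) = (\<Sum>i\<in>{k (Suc r)..<m}. 1 / real i *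
          coeff_iter_sum (k (r - j)) (map (\<lambda>l. k (r - l)) [0..<j]) i)" if "j \<ge> 1" for j
        using that unfolding unfold by (cases j) (simp_all add: upt_rec[of 0] del: upt_Suc)
      have "(\<Sum>j\<in>{1..<Suc r}. ?c j) = ?c 1 + (\<Sum>j\<in>{1..<r}. ?c (Suc j))"
        using False sum.atLeast_Suc_lessThan[of 1 "Suc r" ?c]
        by (simp only: sum.shift_bounds_Suc_ivl)
      also have "(\<Sum>j\<in>{1..<r}. ?c (Suc j)) = (\<Sum>j\<in>{1..<r}. \<Sum>i\<in>{k (Suc r)..<m}. 1 / real i *
          coeff_iter_sum (k (r - j)) (map (\<lambda>l. k (r - l)) [0..<j]) i)"
        by (intro sum.cong refl cSuc) simp
      also have "\<dots> = (\<Sum>i\<in>{k (Suc r)..<m}. \<Sum>j\<in>{1..<r}. 1 / real i *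
          coeff_iter_sum (k (r - j)) (map (\<lambda>l. k (r - l)) [0..<j]) i)"
        by (rule sum.swap)
      finally have "(\<Sum>j\<in>{1..<Suc r}. ?c j) = (\<Sum>i\<in>{k (Suc r)..<m}. coeff_quot (k r) i +
          (\<Sum>j\<in>{1..<r}. 1 / real i *
            coeff_iter_sum (k (r - j)) (map (\<lambda>l. k (r - l)) [0..<j]) i))"
        unfolding c1 by (simp only: sum.distrib)
      also have "\<dots> = (\<Sum>i\<in>{k (Suc r)..<m}. prob_num_sel_less k i r)"
        using False mono le by (intro sum.cong refl Suc.IH[symmetric]) auto
      finally show ?thesis by simp
    qed (simp add: prob_num_sel_less_0)
    with prob_num_sel_less_sum[of k r m] Suc.prems False
    have "real m * prob_num_sel_less k m (Suc r) = real (k (Suc r)) + (\<Sum>j\<in>{1..<Suc r}. ?c j)" by simp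
    then have "prob_num_sel_less k m (Suc r) = real (k (Suc r)) / real m + 1 / real m * (\<Sum>j\<in>{1..<Suc r}. ?c j)"
      using False by (simp add: field_simps)
    then show ?thesis
      using False by (simp add: coeff_quot_def sum_distrib_left del: sum.op_ivl_Suc)
  qed
qed simp

section \<open>Summation over the blocks between consecutive thresholds\<close>

lemma B_eq_sum_prob:
  assumes "mono_on {1..r} k" "r \<ge> 1"
  shows "B k r = (\<Sum>m\<in>{k r..<k (r + 1)}. prob_num_sel_less k m r)"
proof -
  let ?t = "\<lambda>j m. 1 / real m * coeff_iter_sum (k (r - j)) (map (\<lambda>l. k (r - l)) [0..<j]) m"
  have "coeff_iter_sum (k (r - j)) ((k r + 1) # map (\<lambda>l. k (r - l)) [0..<j]) (k (r + 1)) =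
      (\<Sum>m\<in>{k r..<k (r + 1)}. ?t j m)" if "j \<in> {1..<r}" for j
  proof -
    from that have upt: "[0..<j] = 0 # [1..<j]" by (simp add: upt_rec[of 0])
    \<comment> \<open>The outer sum in \<open>B\<close> starts at \<open>k r + 1\<close>, the block
      at \<open>k r\<close>; the extra term vanishes because its inner sum ranges over the empty set
      \<open>{k r..<k r}\<close>.\<close>
    have "?t j (k r) = 0"
      unfolding upt list.map by (cases "map (\<lambda>l. k (r - l)) [1..<j]") (simp_all only:, simp_all)
    then have "(\<Sum>m\<in>{k r + 1..<k (r + 1)}. ?t j m) = (\<Sum>m\<in>{k r..<k (r + 1)}. ?t j m)"
      by (cases "k r < k (r + 1)") (simp_all add: sum.atLeast_Suc_lessThan)
    then show ?thesis unfolding upt by simp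
  qed
  then have "B k r = (\<Sum>m\<in>{k r..<k (r + 1)}. coeff_quot (k r) m) +
      (\<Sum>j\<in>{1..<r}. \<Sum>m\<in>{k r..<k (r + 1)}. ?t j m)"
    unfolding B_def by simp
  also have "\<dots> = (\<Sum>m\<in>{k r..<k (r + 1)}. coeff_quot (k r) m + (\<Sum>j\<in>{1..<r}. ?t j m))"
    by (subst sum.swap) (simp add: sum.distrib)
  also have "\<dots> = (\<Sum>m\<in>{k r..<k (r + 1)}. prob_num_sel_less k m r)"
    using assms by (intro sum.cong refl prob_num_sel_less_eq_iter_sum[symmetric]) auto
  finally show ?thesis .
qed

text \<open>The \<open>m\<close>-th summand is the contribution of appending a new maximum at
  position \<open>m + 1\<close>; appending a smaller value preserves success or failure.\<close>

lemma W_sum: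
  "real N * (real (W N s k) / fact N) = (\<Sum>m<N. real (card {\<sigma>. \<sigma> permutes {1..m} \<and>
     num_sel k \<sigma> m < s \<and> k (Suc (num_sel k \<sigma> m)) \<le> m}) / fact m)"
proof (induction N)
  case (Suc N)
  have "W (Suc N) s k = N * W N s k + card {\<sigma>. \<sigma> permutes {1..N} \<and>
      num_sel k \<sigma> N < s \<and> k (Suc (num_sel k \<sigma> N)) \<le> N}"
    unfolding W_eq_card_sel_best
    by (rule card_permutes_Suc) (simp_all only: sel_best_append_max sel_best_append_less)
  then have "real (Suc N) * (real (W (Suc N) s k) / fact (Suc N)) =
      real N * (real (W N s k) / fact N) + real (card {\<sigma>. \<sigma> permutes {1..N} \<and>
      num_sel k \<sigma> N < s \<and> k (Suc (num_sel k \<sigma> N)) \<le> N}) / fact N"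
    unfolding mult_divide_fact_Suc by (simp add: add_divide_distrib)
  with Suc.IH show ?case by simp
qed simp

lemma sum_consecutive_intervals:
  fixes f :: "nat \<Rightarrow> real"
  assumes "mono_on {1..Suc t} k"
  shows "(\<Sum>r=1..t. \<Sum>m\<in>{k r..<k (r + 1)}. f m) = (\<Sum>m\<in>{k 1..<k (Suc t)}. f m)"
  using assms
proof (induction t)
  case (Suc t)
  have "mono_on {1..Suc t} k" using Suc.prems by (rule mono_on_subset) auto
  moreover have "k 1 \<le> k (Suc t)" "k (Suc t) \<le> k (Suc (Suc t))"
    using mono_onD[OF Suc.prems, of 1 "Suc t"] mono_onD[OF Suc.prems, of "Suc t" "Suc (Suc t)"] by auto
  ultimately show ?case
    using Suc.IH by (simp add: sum.atLeastLessThan_concat)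
qed simp

theorem mainTheorem13:
  fixes s N :: nat and k :: "nat \<Rightarrow> nat"
  assumes "s \<ge> 1"
    and "mono_on {1..s} k"
    and "N \<ge> k s + 1"
  shows "real (W N s k) / fact N = 1 / real N * (\<Sum>r=1..s. B (k(s + 1 := N)) r)"
proof -
  \<comment> \<open>The value \<open>N\<close> at \<open>s + 1\<close> closes the last block and
    keeps the thresholds monotone.\<close>
  define K where "K = k(s + 1 := N)"
  let ?f = "\<lambda>m. real (card {\<sigma>. \<sigma> permutes {1..m} \<and>
     num_sel K \<sigma> m < s \<and> K (Suc (num_sel K \<sigma> m)) \<le> m}) / fact m"
  have "k i \<le> N" if "i \<in> {1..s}" for i
    using mono_onD[OF assms(2), of i s] assms that by auto
  then have mono: "mono_on {1..Suc s} K"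
    using mono_onD[OF assms(2)] by (auto simp: K_def mono_on_def le_Suc_eq)
  \<comment> \<open>The first \<open>s\<close> selections consult only
    \<open>k 1, ..., k s\<close>.\<close>
  have W: "W N s k = W N s K"
  proof -
    have sel: "selection N k' \<pi> i p" if "selection N k'' \<pi> i p" "i \<le> s" "\<And>i. i \<le> s \<Longrightarrow> k' i = k'' i"
      for \<pi> i p and k' k'' :: "nat \<Rightarrow> nat"
      using that
    proof (induction rule: selection.induct)
      case (first p)
      then show ?case using selection.first[of N \<pi> k' p] by simp
    next
      case (later i q p)
      then show ?case using selection.later[of N k' \<pi> i q p] by simp
    qed
    have "selection N k \<pi> i p \<longleftrightarrow> selection N K \<pi> i p" if "i \<in> {1..s}" for \<pi> i p
      using that sel[of k \<pi> i p K] sel[of K \<pi> i p k] by (auto simp: K_def)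
    then show ?thesis by (simp add: W_def)
  qed
  have event: "?f m = prob_num_sel_less K m r" if r: "r \<in> {1..s}" and m: "m \<in> {K r..<K (r + 1)}" for r m
  proof -
    \<comment> \<open>If \<open>c < r\<close>, then \<open>K (Suc c) <= K r <= m\<close>; if
      \<open>r <= c < s\<close>, then \<open>m < K (r + 1) <= K (Suc c)\<close>.\<close>
    have "(c < s \<and> K (Suc c) \<le> m) \<longleftrightarrow> c < r" for c
      using r m mono_onD[OF mono, of "Suc c" r] mono_onD[OF mono, of "r + 1" "Suc c"]
      by (cases "c < r") auto
    then show ?thesis by (simp add: prob_num_sel_less_def)
  qed
  \<comment> \<open>Positions up to \<open>K 1\<close> are always rejected, so the sum may start at
    the first block.\<close>
  have "?f m = 0" if "m < K 1" for m
  proof -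
    have "\<not> (c < s \<and> K (Suc c) \<le> m)" for c
      using that mono_onD[OF mono, of 1 "Suc c"] by auto
    then have empty: "{\<sigma>. \<sigma> permutes {1..m} \<and> num_sel K \<sigma> m < s \<and> K (Suc (num_sel K \<sigma> m)) \<le> m} = {}"
      by blast
    show ?thesis unfolding empty by simp
  qed
  then have "(\<Sum>m<N. ?f m) = (\<Sum>m\<in>{K 1..<N}. ?f m)"
    by (intro sum.mono_neutral_right) (auto simp: not_le)
  also have "\<dots> = (\<Sum>r=1..s. \<Sum>m\<in>{K r..<K (r + 1)}. ?f m)"
    using sum_consecutive_intervals[OF mono, of ?f] by (simp add: K_def)
  also have "\<dots> = (\<Sum>r=1..s. \<Sum>m\<in>{K r..<K (r + 1)}. prob_num_sel_less K m r)"
    using event by (intro sum.cong refl) simp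
  also have "\<dots> = (\<Sum>r=1..s. B K r)"
    by (intro sum.cong refl B_eq_sum_prob[symmetric] mono_on_subset[OF mono]) auto
  finally have "real N * (real (W N s k) / fact N) = (\<Sum>r=1..s. B K r)"
    unfolding W W_sum .
  moreover have "N > 0" using assms(3) by simp
  ultimately show ?thesis
    unfolding K_def by (simp add: field_simps)
qed

end
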